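(* Let $M$ be a compact connected complex manifold of complex dimension $n\ge 2$, let $\omega,\chi$ be Hermitian metrics on $M$, and let $F\in C^\infty(M,\mathbb R)$. Assume that there exist $\underline\varphi,\overline\varphi\in\mathcal H_\chi$ and $\lambda\in\mathbb R$ such that $\mathcal Q_F(\underline\varphi)\ge\lambda$ and $\mathcal Q_F(\overline\varphi)\le\lambda$ on $M$. Then for every $\varphi_0\in\mathcal H_\chi$ there are constants $A_0,B_0\in\mathbb R$ such that the solution $\varphi$ of the flow $\partial_t\varphi=\mathcal Q_F(\varphi)$, $\varphi(\cdot,0)=\varphi_0$, satisfies $$\underline\varphi+A_0\le\varphi(t)-\lambda t\le\overline\varphi+B_0\quad\text{on }M$$ for every $t$ in its maximal existence interval $[0,T_{\max})$. In particular, there is a constant $C$ with $$\sup_{M\times[0,T_{\max})}|\varphi(x,t)-\lambda t|\le C.$$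
   Context: Hermitian metrics are identified with their positive real $(1,1)$-forms; no closedness is assumed. $\mathcal H_\chi=\{\varphi\in C^\infty(M,\mathbb R):\chi_\varphi:=\chi+\sqrt{-1}\,\partial\bar\partial\varphi>0\}$. For $\varphi\in\mathcal H_\chi$, $$\mathcal Q_F(\varphi)=\log\frac{\chi_\varphi^n}{\omega\wedge\chi_\varphi^{n-1}}+F=\log n-\log\operatorname{tr}_{\chi_\varphi}\omega+F.$$ Solutions are smooth and admissible, i.e. $\varphi(\cdot,t)\in\mathcal H_\chi$ for every $t$; for each $\varphi_0\in\mathcal H_\chi$ there is a unique such solution on a maximal interval $[0,T_{\max})$, $0<T_{\max}\le\infty$. *)

theory Defs
  imports "HOL-Analysis.Analysis"
begin

section \<open>Smooth and holomorphic maps between Euclidean spaces\<close>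

text \<open>\<open>Ck_on k f S\<close> is meant for open \<open>S\<close>: all iterated directional derivatives of order at
  most \<open>k\<close> exist and are continuous on \<open>S\<close>.\<close>

primrec Ck_on :: "nat \<Rightarrow> ('a::real_normed_vector \<Rightarrow> 'b::real_normed_vector) \<Rightarrow> 'a set \<Rightarrow> bool" where
  "Ck_on 0 f S \<longleftrightarrow> continuous_on S f"
| "Ck_on (Suc k) f S \<longleftrightarrow>
     (\<forall>x\<in>S. f differentiable (at x)) \<and> (\<forall>v. Ck_on k (\<lambda>x. frechet_derivative f (at x) v) S)"

text \<open>Smoothness on an arbitrary subset \<open>S\<close> of a Euclidean space, in the usual sense of the existence
  of local smooth extensions. For open \<open>S\<close> this says that \<open>f\<close> is of class \<open>C\<^sup>\<infinity>\<close> on \<open>S\<close>; for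
  \<open>S = V \<times> [0,T)\<close> it is smoothness up to the boundary \<open>t = 0\<close>.\<close>

definition smooth_on :: "'a::real_normed_vector set \<Rightarrow> ('a \<Rightarrow> 'b::real_normed_vector) \<Rightarrow> bool" where
  "smooth_on S f \<longleftrightarrow>
     (\<forall>x\<in>S. \<exists>W g. open W \<and> x \<in> W \<and> (\<forall>k. Ck_on k g W) \<and> (\<forall>y\<in>S \<inter> W. f y = g y))"

definition holomorphic_map_on :: "(complex^'n) set \<Rightarrow> (complex^'n \<Rightarrow> complex^'n) \<Rightarrow> bool" where
  "holomorphic_map_on S f \<longleftrightarrow>
     (\<forall>z\<in>S. \<exists>D. (f has_derivative D) (at z) \<and> (\<forall>c v. D (c *s v) = c *s D v))"

definition holomorphic_jacobian :: "(complex^'n \<Rightarrow> complex^'n) \<Rightarrow> complex^'n \<Rightarrow> complex^'n^'n" where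
  "holomorphic_jacobian f z = (\<chi> k j. frechet_derivative f (at z) (axis j 1) $ k)"

text \<open>The Wirtinger operators \<open>\<partial>/\<partial>z\<^sub>j = (\<partial>/\<partial>x\<^sub>j - i \<partial>/\<partial>y\<^sub>j)/2\<close> and
  \<open>\<partial>/\<partial>\<zeta>\<^sub>j = (\<partial>/\<partial>x\<^sub>j + i \<partial>/\<partial>y\<^sub>j)/2\<close>, where \<open>\<zeta>\<^sub>j\<close> is the conjugate of \<open>z\<^sub>j = x\<^sub>j + i y\<^sub>j\<close>.\<close>

definition d_z :: "'n \<Rightarrow> (complex^'n \<Rightarrow> complex) \<Rightarrow> complex^'n \<Rightarrow> complex" where
  "d_z j f z =
     (frechet_derivative f (at z) (axis j 1) - \<i> * frechet_derivative f (at z) (axis j \<i>)) / 2"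

definition d_zbar :: "'n \<Rightarrow> (complex^'n \<Rightarrow> complex) \<Rightarrow> complex^'n \<Rightarrow> complex" where
  "d_zbar j f z =
     (frechet_derivative f (at z) (axis j 1) + \<i> * frechet_derivative f (at z) (axis j \<i>)) / 2"

section \<open>Complex manifolds\<close>

text \<open>A chart is a pair \<open>(U, z)\<close> of a coordinate domain and a coordinate map; the complex dimension
  is \<open>CARD('n)\<close>.\<close>

type_synonym ('a, 'n) chart = "'a set \<times> ('a \<Rightarrow> complex^'n)"

abbreviation dom_chart :: "('a, 'n) chart \<Rightarrow> 'a set" where
  "dom_chart c \<equiv> fst c"

abbreviation img_chart :: "('a, 'n) chart \<Rightarrow> (complex^'n) set" where
  "img_chart c \<equiv> snd c ` fst c"

abbreviation inv_chart :: "('a, 'n) chart \<Rightarrow> complex^'n \<Rightarrow> 'a" where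
  "inv_chart c \<equiv> inv_into (fst c) (snd c)"

definition is_chart :: "'a topology \<Rightarrow> ('a, 'n::finite) chart \<Rightarrow> bool" where
  "is_chart M c \<longleftrightarrow>
     openin M (dom_chart c) \<and> open (img_chart c) \<and>
     homeomorphic_map (subtopology M (dom_chart c)) (top_of_set (img_chart c)) (snd c)"

definition complex_manifold :: "'a topology \<Rightarrow> ('a, 'n::finite) chart set \<Rightarrow> bool" where
  "complex_manifold M A \<longleftrightarrow>
     Hausdorff_space M \<and> second_countable M \<and>
     (\<forall>c\<in>A. is_chart M c) \<and> (\<Union>c\<in>A. dom_chart c) = topspace M \<and>
     (\<forall>c\<in>A. \<forall>d\<in>A. holomorphic_map_on (snd c ` (dom_chart c \<inter> dom_chart d)) (snd d \<circ> inv_chart c))"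

definition smooth_function :: "('a, 'n::finite) chart set \<Rightarrow> ('a \<Rightarrow> real) \<Rightarrow> bool" where
  "smooth_function A f \<longleftrightarrow> (\<forall>c\<in>A. smooth_on (img_chart c) (f \<circ> inv_chart c))"

text \<open>The half-open time interval \<open>[0,T)\<close>, where \<open>T\<close> may be infinite.\<close>

definition time_interval :: "ereal \<Rightarrow> real set" where
  "time_interval T = {t. 0 \<le> t \<and> ereal t < T}"

definition smooth_on_cylinder ::
    "('a, 'n::finite) chart set \<Rightarrow> ereal \<Rightarrow> ('a \<Rightarrow> real \<Rightarrow> real) \<Rightarrow> bool" where
  "smooth_on_cylinder A T \<phi> \<longleftrightarrow>
     (\<forall>c\<in>A. smooth_on (img_chart c \<times> time_interval T) (\<lambda>(y, t). \<phi> (inv_chart c y) t))"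

section \<open>Forms of type (1,1) and Hermitian metrics\<close>

text \<open>A (1,1)-form \<open>\<alpha>\<close> is given by its coefficient matrices: in a chart \<open>c\<close> with coordinates \<open>z\<close>,
  \<open>\<alpha> = i \<Sum>\<^sub>j\<^sub>k (\<alpha> c p $ j $ k) dz\<^sub>j \<and> d\<zeta>\<^sub>k\<close> at \<open>p\<close>, with \<open>\<zeta>\<^sub>k\<close> the conjugate of \<open>z\<^sub>k\<close>. Only the values
  for \<open>c\<close> in the atlas and \<open>p\<close> in the domain of \<open>c\<close> are relevant.\<close>

type_synonym ('a, 'n) form11 = "('a, 'n) chart \<Rightarrow> 'a \<Rightarrow> complex^'n^'n"

text \<open>If \<open>w\<^sub>k\<close> are the coordinates of \<open>d\<close> and \<open>z\<^sub>i\<close> those of \<open>c\<close>, then \<open>dw\<^sub>k = \<Sum>\<^sub>i J\<^sub>k\<^sub>i dz\<^sub>i\<close>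
  with \<open>J\<close> the holomorphic Jacobian of the transition map from \<open>c\<close> to \<open>d\<close>.\<close>

definition smooth_form11 :: "('a, 'n::finite) chart set \<Rightarrow> ('a, 'n) form11 \<Rightarrow> bool" where
  "smooth_form11 A \<alpha> \<longleftrightarrow>
     (\<forall>c\<in>A. smooth_on (img_chart c) (\<alpha> c \<circ> inv_chart c)) \<and>
     (\<forall>c\<in>A. \<forall>d\<in>A. \<forall>p \<in> dom_chart c \<inter> dom_chart d.
        let J = holomorphic_jacobian (snd d \<circ> inv_chart c) (snd c p)
        in \<forall>i j. \<alpha> c p $ i $ j =
             (\<Sum>k\<in>UNIV. \<Sum>l\<in>UNIV. \<alpha> d p $ k $ l * (J $ k $ i) * cnj (J $ l $ j)))"

definition hermitian_matrix :: "complex^'n^'n \<Rightarrow> bool" where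
  "hermitian_matrix H \<longleftrightarrow> (\<forall>i j. H $ j $ i = cnj (H $ i $ j))"

definition positive_definite_matrix :: "complex^'n^'n \<Rightarrow> bool" where
  "positive_definite_matrix H \<longleftrightarrow>
     hermitian_matrix H \<and>
     (\<forall>v. v \<noteq> 0 \<longrightarrow> 0 < Re (\<Sum>i\<in>UNIV. \<Sum>j\<in>UNIV. H $ i $ j * v $ i * cnj (v $ j)))"

text \<open>A (1,1)-form is real iff its coefficient matrices are Hermitian.\<close>

definition positive_form11 :: "('a, 'n::finite) chart set \<Rightarrow> ('a, 'n) form11 \<Rightarrow> bool" where
  "positive_form11 A \<alpha> \<longleftrightarrow> (\<forall>c\<in>A. \<forall>p\<in>dom_chart c. positive_definite_matrix (\<alpha> c p))"

definition hermitian_metric :: "('a, 'n::finite) chart set \<Rightarrow> ('a, 'n) form11 \<Rightarrow> bool" where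
  "hermitian_metric A \<alpha> \<longleftrightarrow> smooth_form11 A \<alpha> \<and> positive_form11 A \<alpha>"

definition i_ddbar :: "('a \<Rightarrow> real) \<Rightarrow> ('a, 'n::finite) form11" where
  "i_ddbar \<phi> c p =
     (\<chi> j k. d_z j (d_zbar k (\<lambda>y. complex_of_real (\<phi> (inv_chart c y)))) (snd c p))"

definition perturbed_form :: "('a, 'n::finite) form11 \<Rightarrow> ('a \<Rightarrow> real) \<Rightarrow> ('a, 'n) form11" where
  "perturbed_form chi \<phi> c p = chi c p + i_ddbar \<phi> c p"

definition admissible_potentials ::
    "('a, 'n::finite) chart set \<Rightarrow> ('a, 'n) form11 \<Rightarrow> ('a \<Rightarrow> real) set" where
  "admissible_potentials A chi =
     {\<phi>. smooth_function A \<phi> \<and> positive_form11 A (perturbed_form chi \<phi>)}"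

section \<open>The operator and its flow\<close>

text \<open>For (1,1)-forms \<open>\<alpha>\<^sub>k = i \<Sum>\<^sub>p\<^sub>q (a k $ p $ q) dz\<^sub>p \<and> d\<zeta>\<^sub>q\<close>, one for each \<open>k :: 'n\<close>, this is the
  coefficient of the wedge product of all the \<open>\<alpha>\<^sub>k\<close> with respect to the volume form
  \<open>\<And>\<^sub>k (i dz\<^sub>k \<and> d\<zeta>\<^sub>k)\<close>. The \<open>\<alpha>\<^sub>k\<close> commute, so no ordering of the factors is needed.\<close>

definition wedge_top :: "('n::finite \<Rightarrow> complex^'n^'n) \<Rightarrow> complex" where
  "wedge_top a =
     (\<Sum>\<sigma> | \<sigma> permutes UNIV. \<Sum>\<tau> | \<tau> permutes UNIV.
        of_int (sign \<sigma> * sign \<tau>) * (\<Prod>k\<in>UNIV. a k $ \<sigma> k $ \<tau> k))"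

text \<open>The coefficients of \<open>\<eta>\<^sup>n\<close> and of \<open>\<alpha> \<and> \<eta>\<^sup>n\<^sup>-\<^sup>1\<close>; in the latter, which one of the
  \<open>n\<close> factors is \<open>\<alpha>\<close> is immaterial.\<close>

definition power_top :: "complex^'n^'n \<Rightarrow> complex" where
  "power_top H = wedge_top (\<lambda>k::'n::finite. H)"

definition wedge_power_top :: "complex^'n^'n \<Rightarrow> complex^'n^'n \<Rightarrow> complex" where
  "wedge_power_top W H = wedge_top (\<lambda>k::'n::finite. if k = (SOME l. True) then W else H)"

text \<open>The lemma \<open>top_quotient_eq\<close> below says that the quotient of \<open>\<eta>\<^sup>n\<close> by
  \<open>\<alpha> \<and> \<eta>\<^sup>n\<^sup>-\<^sup>1\<close> is \<open>n\<close> divided by the trace of \<open>\<alpha>\<close> with respect to \<open>\<eta>\<close>.\<close>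

lemma wedge_top_as_det_sum:
  fixes a :: "'n::finite \<Rightarrow> complex^'n^'n"
  shows "wedge_top a = (\<Sum>\<sigma> | \<sigma> permutes UNIV. det (\<chi> i j. a (inv \<sigma> i) $ i $ j))"
  unfolding wedge_top_def
proof (intro sum.cong refl)
  fix \<sigma> :: "'n \<Rightarrow> 'n" assume "\<sigma> \<in> {\<sigma>. \<sigma> permutes UNIV}"
  then have s: "\<sigma> permutes UNIV" by simp
  then have b: "bij \<sigma>" by (simp add: permutes_bij)
  have "(\<Sum>\<tau> | \<tau> permutes UNIV. of_int (sign \<sigma> * sign \<tau>) * (\<Prod>k\<in>UNIV. a k $ \<sigma> k $ \<tau> k))
      = (\<Sum>\<rho> | \<rho> permutes UNIV. of_int (sign \<sigma> * sign (\<rho> \<circ> \<sigma>)) * (\<Prod>k\<in>UNIV. a k $ \<sigma> k $ (\<rho> \<circ> \<sigma>) k))"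
    by (rule sum_permutations_compose_right[OF s])
  also have "\<dots> = (\<Sum>\<rho> | \<rho> permutes UNIV. of_int (sign \<rho>) * (\<Prod>i\<in>UNIV. a (inv \<sigma> i) $ i $ \<rho> i))"
  proof (intro sum.cong refl)
    fix \<rho> :: "'n \<Rightarrow> 'n" assume "\<rho> \<in> {\<rho>. \<rho> permutes UNIV}"
    then have r: "\<rho> permutes UNIV" by simp
    have sg: "sign \<sigma> * sign (\<rho> \<circ> \<sigma>) = sign \<rho>"
    proof -
      have "permutation \<sigma>" "permutation \<rho>"
        using s r by (auto intro: permutes_imp_permutation[OF finite])
      then show ?thesis
        by (simp add: sign_compose mult.left_commute)
    qed
    have "(\<Prod>k\<in>UNIV. a k $ \<sigma> k $ (\<rho> \<circ> \<sigma>) k) = (\<Prod>k\<in>UNIV. a (inv \<sigma> (\<sigma> k)) $ \<sigma> k $ \<rho> (\<sigma> k))"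
      using b by (simp add: bij_is_inj)
    also have "\<dots> = (\<Prod>i\<in>UNIV. a (inv \<sigma> i) $ i $ \<rho> i)"
      by (rule prod.reindex_bij_betw[OF b, of "\<lambda>i. a (inv \<sigma> i) $ i $ \<rho> i"])
    finally show "of_int (sign \<sigma> * sign (\<rho> \<circ> \<sigma>)) * (\<Prod>k\<in>UNIV. a k $ \<sigma> k $ (\<rho> \<circ> \<sigma>) k) =
       (of_int (sign \<rho>) * (\<Prod>i\<in>UNIV. a (inv \<sigma> i) $ i $ \<rho> i) :: complex)"
      using sg by simp
  qed
  also have "\<dots> = det (\<chi> i j. a (inv \<sigma> i) $ i $ j)"
    by (simp add: det_def)
  finally show "(\<Sum>\<tau> | \<tau> permutes UNIV. of_int (sign \<sigma> * sign \<tau>) * (\<Prod>k\<in>UNIV. a k $ \<sigma> k $ \<tau> k))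
      = det (\<chi> i j. a (inv \<sigma> i) $ i $ j)" .
qed

lemma power_top_eq: "power_top (H :: complex^'n^'n) = fact CARD('n) * det H"
proof -
  have "(\<chi> i j. H $ i $ j) = H" by (simp add: vec_eq_iff)
  then show ?thesis
    unfolding power_top_def wedge_top_as_det_sum
    using card_permutations[of "UNIV :: 'n set" "CARD('n)"] by simp
qed

lemma card_permutes_sending:
  fixes a i :: "'n::finite"
  shows "card {\<sigma>. \<sigma> permutes (UNIV::'n set) \<and> \<sigma> a = i} = fact (CARD('n) - 1)"
proof -
  let ?t = "Transposition.transpose a i"
  have t: "?t permutes UNIV" by (simp add: permutes_swap_id)
  have "bij_betw (\<lambda>\<rho>. ?t \<circ> \<rho>) {\<rho>. \<rho> permutes (UNIV - {a})} {\<sigma>. \<sigma> permutes (UNIV::'n set) \<and> \<sigma> a = i}"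
  proof (rule bij_betw_byWitness[where f' = "\<lambda>\<rho>. ?t \<circ> \<rho>"])
    show "(\<lambda>\<rho>. ?t \<circ> \<rho>) ` {\<rho>. \<rho> permutes (UNIV - {a})} \<subseteq> {\<sigma>. \<sigma> permutes (UNIV::'n set) \<and> \<sigma> a = i}"
    proof clarify
      fix \<rho> assume r: "\<rho> permutes (UNIV - {a})"
      have "\<rho> permutes UNIV" by (rule permutes_subset[OF r]) simp
      moreover have "\<rho> a = a" by (rule permutes_not_in[OF r]) simp
      ultimately show "?t \<circ> \<rho> permutes UNIV \<and> (?t \<circ> \<rho>) a = i"
        using permutes_compose[OF _ t] by simp
    qed
    show "(\<lambda>\<rho>. ?t \<circ> \<rho>) ` {\<sigma>. \<sigma> permutes (UNIV::'n set) \<and> \<sigma> a = i} \<subseteq> {\<rho>. \<rho> permutes (UNIV - {a})}"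
    proof clarify
      fix \<sigma> assume s: "\<sigma> permutes (UNIV::'n set)" and i: "i = \<sigma> a"
      have "Transposition.transpose a (\<sigma> a) \<circ> \<sigma> permutes UNIV"
        using permutes_compose[OF s t] i by simp
      then show "Transposition.transpose a (\<sigma> a) \<circ> \<sigma> permutes UNIV - {a}"
        by (rule permutes_superset) simp
    qed
  qed (simp_all add: o_assoc)
  then have "card {\<sigma>. \<sigma> permutes (UNIV::'n set) \<and> \<sigma> a = i} = card {\<rho>. \<rho> permutes (UNIV - {a})}"
    by (rule bij_betw_same_card[symmetric])
  also have "\<dots> = fact (CARD('n) - 1)"
    by (rule card_permutations) (simp_all add: card_Diff_singleton)
  finally show ?thesis .
qed

lemma wedge_power_top_eq:
  fixes W H :: "complex^'n^'n"
  assumes "det H \<noteq> 0"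
  shows "wedge_power_top W H = fact (CARD('n) - 1) * det H * trace (matrix_inv H ** W)"
proof -
  define a :: 'n where "a = (SOME l. True)"
  define D where "D i = det (\<chi> r j. if r = i then W $ i $ j else H $ r $ j)" for i
  let ?P = "{\<sigma>. \<sigma> permutes (UNIV::'n set)}"
  have "wedge_power_top W H = (\<Sum>\<sigma>\<in>?P. D (\<sigma> a))"
    unfolding wedge_power_top_def wedge_top_as_det_sum a_def[symmetric] D_def
  proof (intro sum.cong refl arg_cong[of _ _ det])
    fix \<sigma> assume "\<sigma> \<in> ?P"
    then have "inv \<sigma> r = a \<longleftrightarrow> r = \<sigma> a" for r
      by (metis mem_Collect_eq permutes_inv_eq)
    then show "(\<chi> i j. (if inv \<sigma> i = a then W else H) $ i $ j) =
        (\<chi> r j. if r = \<sigma> a then W $ \<sigma> a $ j else H $ r $ j)"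
      by (simp add: vec_eq_iff)
  qed
  also have "\<dots> = (\<Sum>i\<in>UNIV. \<Sum>\<sigma> | \<sigma> \<in> ?P \<and> \<sigma> a = i. D (\<sigma> a))"
    by (rule sum.group[symmetric]) (auto simp: finite_permutations)
  also have "\<dots> = (\<Sum>i\<in>UNIV. fact (CARD('n) - 1) * D i)"
    by (intro sum.cong refl) (simp add: card_permutes_sending)
  also have "\<dots> = fact (CARD('n) - 1) * (\<Sum>i\<in>UNIV. D i)"
    by (simp add: sum_distrib_left)
  also have "(\<Sum>i\<in>UNIV. D i) = (\<Sum>i\<in>UNIV. (W ** matrix_inv H) $ i $ i * det H)"
  proof (intro sum.cong refl)
    fix i
    let ?x = "row i (W ** matrix_inv H)"
    have inv: "matrix_inv H ** H = mat 1"
    proof -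
      have "\<exists>B. H ** B = mat 1 \<and> B ** H = mat 1"
        using assms by (simp add: invertible_det_nz flip: invertible_def)
      from someI_ex[OF this] show ?thesis by (simp add: matrix_inv_def)
    qed
    have "row i W = row i (W ** matrix_inv H ** H)"
      by (simp add: inv flip: matrix_mul_assoc)
    also have "\<dots> = (\<Sum>k\<in>UNIV. ?x $ k *s row k H)"
      by (simp add: vec_eq_iff row_def matrix_matrix_mult_def[of _ H])
    finally have e: "row i W = (\<Sum>k\<in>UNIV. ?x $ k *s row k H)" .
    have "D i = det (\<chi> r. if r = i then (\<Sum>k\<in>UNIV. ?x $ k *s row k H) else row r H)"
      unfolding D_def e[symmetric] by (intro arg_cong[of _ _ det]) (simp add: vec_eq_iff row_def)
    then show "D i = (W ** matrix_inv H) $ i $ i * det H"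
      using cramer_lemma_transpose[of i ?x H] by (simp add: row_def)
  qed
  also have "\<dots> = det H * trace (matrix_inv H ** W)"
    unfolding trace_mul_sym[of "matrix_inv H" W]
    by (simp add: trace_def sum_distrib_left mult.commute)
  finally show ?thesis by simp
qed

lemma top_quotient_eq:
  fixes W H :: "complex^'n^'n"
  assumes "det H \<noteq> 0"
  shows "power_top H / wedge_power_top W H = of_nat CARD('n) / trace (matrix_inv H ** W)"
proof -
  have f: "(fact CARD('n) :: complex) = of_nat CARD('n) * fact (CARD('n) - 1)"
    by (rule fact_reduce) simp
  have "(fact (CARD('n) - 1) :: complex) \<noteq> 0" by (rule fact_nonzero)
  then show ?thesis using assms
    unfolding power_top_eq wedge_power_top_eq[OF assms] f
    by (metis (no_types, lifting) mult.assoc mult.commute nonzero_mult_divide_mult_cancel_left no_zero_divisors)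
qed

text \<open>The quotient of two (n,n)-forms at \<open>x\<close> is the quotient of their coefficients in any chart
  around \<open>x\<close>; it does not depend on the chart.\<close>

definition Q_op ::
    "('a, 'n::finite) chart set \<Rightarrow> ('a, 'n) form11 \<Rightarrow> ('a, 'n) form11 \<Rightarrow> ('a \<Rightarrow> real) \<Rightarrow>
     ('a \<Rightarrow> real) \<Rightarrow> 'a \<Rightarrow> real" where
  "Q_op A \<omega> chi F \<phi> x =
     (let c = (SOME c. c \<in> A \<and> x \<in> dom_chart c); H = perturbed_form chi \<phi> c x
      in ln (Re (power_top H / wedge_power_top (\<omega> c x) H)) + F x)"

definition flow_solution ::
    "'a topology \<Rightarrow> ('a, 'n::finite) chart set \<Rightarrow> ('a, 'n) form11 \<Rightarrow> ('a, 'n) form11 \<Rightarrow>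
     ('a \<Rightarrow> real) \<Rightarrow> ('a \<Rightarrow> real) \<Rightarrow> ereal \<Rightarrow> ('a \<Rightarrow> real \<Rightarrow> real) \<Rightarrow> bool" where
  "flow_solution M A \<omega> chi F \<phi>0 T \<phi> \<longleftrightarrow>
     0 < T \<and> smooth_on_cylinder A T \<phi> \<and>
     (\<forall>t\<in>time_interval T. (\<lambda>x. \<phi> x t) \<in> admissible_potentials A chi) \<and>
     (\<forall>x\<in>topspace M. \<phi> x 0 = \<phi>0 x) \<and>
     (\<forall>x\<in>topspace M. \<forall>t\<in>time_interval T.
        ((\<lambda>s. \<phi> x s) has_real_derivative Q_op A \<omega> chi F (\<lambda>y. \<phi> y t) x)
          (at t within time_interval T))"

definition maximal_flow_solution ::
    "'a topology \<Rightarrow> ('a, 'n::finite) chart set \<Rightarrow> ('a, 'n) form11 \<Rightarrow> ('a, 'n) form11 \<Rightarrow>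
     ('a \<Rightarrow> real) \<Rightarrow> ('a \<Rightarrow> real) \<Rightarrow> ereal \<Rightarrow> ('a \<Rightarrow> real \<Rightarrow> real) \<Rightarrow> bool" where
  "maximal_flow_solution M A \<omega> chi F \<phi>0 T \<phi> \<longleftrightarrow>
     flow_solution M A \<omega> chi F \<phi>0 T \<phi> \<and>
     (\<forall>T' \<psi>. flow_solution M A \<omega> chi F \<phi>0 T' \<psi> \<longrightarrow> T' \<le> T)"

end

theory Submission
  imports Defs
begin

text \<open>This is the parabolic maximum principle. At a point where \<open>\<phi>(t) - \<psi>\<close> is minimal over \<open>M\<close>, the
  complex Hessian of \<open>\<phi>\<close> dominates that of \<open>\<psi>\<close>, so \<open>\<chi>\<^sub>\<phi> \<ge> \<chi>\<^sub>\<psi>\<close>; since \<open>\<eta> \<mapsto> tr\<^sub>\<eta> \<omega>\<close> is decreasing, the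
  operator at \<open>\<phi>\<close> is there at least the operator at \<open>\<psi>\<close>. If \<open>\<psi>\<close> is a subsolution, the time derivative
  of \<open>\<phi> - \<lambda> t - \<psi> + \<epsilon> t\<close> is therefore positive at such a point, which thus cannot be a minimum over
  \<open>M \<times> [0,t]\<close> with positive time. Exchanging \<open>\<phi>\<close> and \<open>\<psi>\<close> gives the upper bound.\<close>

section \<open>Positive Hermitian matrices\<close>

text \<open>The sum in \<open>positive_definite_matrix\<close>, polarized: linear in
  \<open>u\<close>, conjugate linear in \<open>v\<close>. Two separate arguments make it possible to
  complete squares.\<close>

definition sesq :: "complex^'n^'n \<Rightarrow> complex^'n \<Rightarrow> complex^'n \<Rightarrow> complex" where
  "sesq H u v = (\<Sum>i\<in>UNIV. \<Sum>j\<in>UNIV. H $ i $ j * u $ i * cnj (v $ j))"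

text \<open>Schur complements and differences of inverses are in general only semidefinite, so the
  trace inequality is proved in this class.\<close>

definition psd :: "complex^'n^'n \<Rightarrow> bool" where
  "psd H \<longleftrightarrow> hermitian_matrix H \<and> (\<forall>v. 0 \<le> Re (sesq H v v))"

lemma positive_definite_matrix_sesq:
  "positive_definite_matrix H \<longleftrightarrow> hermitian_matrix H \<and> (\<forall>v. v \<noteq> 0 \<longrightarrow> 0 < Re (sesq H v v))"
  by (simp add: positive_definite_matrix_def sesq_def)

lemma sesq_add_left: "sesq H (u + v) w = sesq H u w + sesq H v w"
  by (simp add: sesq_def sum.distrib algebra_simps)

lemma sesq_add_right: "sesq H w (u + v) = sesq H w u + sesq H w v"
  by (simp add: sesq_def sum.distrib algebra_simps)

lemma sesq_diff_left: "sesq H (u - v) w = sesq H u w - sesq H v w"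
  by (simp add: sesq_def sum_subtractf algebra_simps)

lemma sesq_diff_right: "sesq H w (u - v) = sesq H w u - sesq H w v"
  by (simp add: sesq_def sum_subtractf algebra_simps)

lemma sesq_scale_left: "sesq H (c *s u) w = c * sesq H u w"
  by (simp add: sesq_def sum_distrib_left algebra_simps)

lemma sesq_scale_right: "sesq H u (c *s w) = cnj c * sesq H u w"
  by (simp add: sesq_def sum_distrib_left algebra_simps)

lemma sesq_matrix_diff: "sesq (H - K) u v = sesq H u v - sesq K u v"
  by (simp add: sesq_def sum_subtractf algebra_simps)

lemma sesq_matrix_add: "sesq (H + K) u v = sesq H u v + sesq K u v"
  by (simp add: sesq_def sum.distrib algebra_simps)

lemmas sesq_expand = sesq_add_left sesq_add_right sesq_diff_left sesq_diff_right
  sesq_scale_left sesq_scale_right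

lemma sesq_zero_left [simp]: "sesq H 0 v = 0"
  by (simp add: sesq_def)

lemma sesq_axis_right: "sesq H u (axis j 1) = (\<Sum>i\<in>UNIV. H $ i $ j * u $ i)"
proof -
  have "(\<Sum>k\<in>UNIV. H $ i $ k * u $ i * cnj (axis j 1 $ k))
      = (\<Sum>k\<in>UNIV. if k = j then H $ i $ k * u $ i else 0)" for i
    by (intro sum.cong) (auto simp: axis_def)
  then show ?thesis by (simp add: sesq_def)
qed

lemma sesq_axis: "sesq H (axis i 1) (axis j 1) = H $ i $ j"
proof -
  have "(\<Sum>k\<in>UNIV. H $ k $ j * axis i 1 $ k) = (\<Sum>k\<in>UNIV. if k = i then H $ k $ j else 0)"
    by (intro sum.cong) (auto simp: axis_def)
  then show ?thesis by (simp add: sesq_axis_right)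
qed

lemma hermitian_matrix_entry: "hermitian_matrix H \<Longrightarrow> cnj (H $ i $ j) = H $ j $ i"
  by (metis hermitian_matrix_def)

lemma hermitian_sesq_cnj:
  assumes "hermitian_matrix H"
  shows "cnj (sesq H u v) = sesq H v u"
proof -
  have "cnj (sesq H u v) = (\<Sum>i\<in>UNIV. \<Sum>j\<in>UNIV. H $ j $ i * v $ j * cnj (u $ i))"
    using assms by (simp add: sesq_def hermitian_matrix_entry mult_ac)
  also have "\<dots> = sesq H v u"
    unfolding sesq_def by (rule sum.swap)
  finally show ?thesis .
qed

lemma hermitian_matrixI_sesq:
  assumes "\<And>u v. cnj (sesq H u v) = sesq H v u"
  shows "hermitian_matrix H"
  unfolding hermitian_matrix_def by (metis assms sesq_axis)

lemma psd_hermitian: "psd H \<Longrightarrow> hermitian_matrix H"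
  by (simp add: psd_def)

lemma positive_definite_imp_psd: "positive_definite_matrix H \<Longrightarrow> psd H"
  unfolding positive_definite_matrix_sesq psd_def
  by (metis less_eq_real_def sesq_zero_left zero_complex.simps(1))

lemma psd_diagonal:
  assumes "psd W"
  shows "W $ a $ a = of_real (Re (W $ a $ a))" "0 \<le> Re (W $ a $ a)"
proof -
  have "cnj (W $ a $ a) = W $ a $ a"
    using assms by (metis psd_def hermitian_matrix_def)
  then show "W $ a $ a = of_real (Re (W $ a $ a))"
    by (metis Reals_cnj_iff of_real_Re)
  show "0 \<le> Re (W $ a $ a)"
    using assms by (metis psd_def sesq_axis)
qed

text \<open>One step of the Cholesky decomposition of \<open>W\<close>: the Schur complement of the pivot \<open>W a a\<close> is
  again positive semidefinite, and the part split off has rank one.\<close>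

lemma schur_step:
  fixes W K :: "complex^'n^'n"
  assumes W: "psd W" and a: "W $ a $ a \<noteq> 0"
  obtains W' where "psd W'" "{i. W' $ i $ i \<noteq> 0} \<subset> {i. W $ i $ i \<noteq> 0}"
    "trace (K ** W) = trace (K ** W') + sesq K (W $ a) (W $ a) / of_real (Re (W $ a $ a))"
    "0 < Re (W $ a $ a)"
proof -
  define d where "d = Re (W $ a $ a)"
  have Waa: "W $ a $ a = of_real d" and d: "d > 0"
    using psd_diagonal[OF W, of a] a by (auto simp: d_def complex_eq_iff)
  have h: "hermitian_matrix W" using W by (rule psd_hermitian)
  have hc: "cnj (W $ i $ j) = W $ j $ i" for i j
    by (rule hermitian_matrix_entry[OF h])
  define W' where "W' = (\<chi> i j. W $ i $ j - W $ i $ a * W $ a $ j / of_real d)"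
  \<comment> \<open>The vector on the right is \<open>v\<close> minus its
    \<open>W\<close>-orthogonal projection onto \<open>axis a 1\<close>; hence \<open>W'\<close>
    inherits semidefiniteness from \<open>W\<close>.\<close>
  have form: "sesq W' v v = sesq W (v - (sesq W v (axis a 1) / of_real d) *s axis a 1)
                                  (v - (sesq W v (axis a 1) / of_real d) *s axis a 1)" for v
  proof -
    let ?s = "sesq W v (axis a 1)"
    have s: "?s = (\<Sum>i\<in>UNIV. W $ i $ a * v $ i)" by (rule sesq_axis_right)
    have s': "cnj ?s = (\<Sum>j\<in>UNIV. W $ a $ j * cnj (v $ j))"
      by (simp add: s hc)
    have "sesq W' v v = sesq W v v - ?s * cnj ?s / of_real d"
      unfolding s' unfolding s
      by (simp add: sesq_def W'_def sum_subtractf algebra_simps sum_product sum_divide_distrib)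
    moreover have "sesq W (axis a 1) v = cnj ?s"
      by (simp add: hermitian_sesq_cnj[OF h])
    ultimately show ?thesis using d
      by (simp add: sesq_expand sesq_axis Waa field_simps)
  qed
  have "psd W'"
    unfolding psd_def
  proof
    show "hermitian_matrix W'"
      unfolding hermitian_matrix_def W'_def by (simp add: hc mult.commute)
    show "\<forall>v. 0 \<le> Re (sesq W' v v)"
      using W by (simp add: form psd_def)
  qed
  moreover have "{i. W' $ i $ i \<noteq> 0} \<subset> {i. W $ i $ i \<noteq> 0}"
  proof
    \<comment> \<open>A vanishing diagonal entry stays zero: its new value is at most 0 by the
      formula for \<open>W'\<close> and at least 0 by semidefiniteness.\<close>
    have "W' $ i $ i = 0" if "W $ i $ i = 0" for i
    proof -
      have "Re (W' $ i $ i) = - ((cmod (W $ i $ a))\<^sup>2 / d)"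
      proof -
        have "W $ i $ a * W $ a $ i = of_real ((cmod (W $ i $ a))\<^sup>2)"
          by (metis complex_norm_square hc)
        then show ?thesis using that by (simp add: W'_def)
      qed
      also have "\<dots> \<le> 0" using d by simp
      finally show ?thesis
        using psd_diagonal[OF \<open>psd W'\<close>, of i] by simp
    qed
    then show "{i. W' $ i $ i \<noteq> 0} \<subseteq> {i. W $ i $ i \<noteq> 0}" by blast
    have "W' $ a $ a = 0" using d by (simp add: W'_def Waa)
    then show "{i. W' $ i $ i \<noteq> 0} \<noteq> {i. W $ i $ i \<noteq> 0}" using a by blast
  qed
  \<comment> \<open>The part split off has entries \<open>W $ i $ a * W $ a $ j / d\<close>. Since
    \<open>W $ i $ a\<close> is the conjugate of \<open>W $ a $ i\<close>, its trace against
    \<open>K\<close> is the form of \<open>K\<close> on row \<open>a\<close>, divided by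
    \<open>d\<close>.\<close>
  moreover have "trace (K ** W) = trace (K ** W') + sesq K (W $ a) (W $ a) / of_real d"
    by (simp add: trace_def matrix_matrix_mult_def W'_def sesq_def hc sum_subtractf
        algebra_simps sum_divide_distrib)
  ultimately show ?thesis using that d unfolding d_def by blast
qed

text \<open>On the test vector below both cross terms equal minus the squared modulus of
  \<open>W $ i $ j\<close>, and the diagonal contributes nothing. This settles the case in which no
  pivot is left.\<close>

lemma psd_zero_diagonal:
  assumes W: "psd W" and "\<And>i. W $ i $ i = 0"
  shows "W = 0"
proof -
  have "W $ i $ j = 0" for i j
  proof -
    let ?v = "axis i 1 + (- W $ i $ j) *s axis j 1"
    have "W $ j $ i = cnj (W $ i $ j)"
      using hermitian_matrix_entry[OF psd_hermitian[OF W]] by simp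
    then have "sesq W ?v ?v = - 2 * (W $ i $ j * cnj (W $ i $ j))"
      by (simp only: sesq_expand sesq_axis assms(2)) (simp add: algebra_simps)
    also have "\<dots> = of_real (- 2 * (cmod (W $ i $ j))\<^sup>2)"
      by (simp only: complex_norm_square[symmetric]) simp
    finally have "Re (sesq W ?v ?v) = - 2 * (cmod (W $ i $ j))\<^sup>2" by simp
    moreover have "0 \<le> Re (sesq W ?v ?v)" using W by (simp add: psd_def)
    ultimately have "(cmod (W $ i $ j))\<^sup>2 \<le> 0" by linarith
    then show ?thesis by simp
  qed
  then show ?thesis by (simp add: vec_eq_iff)
qed

section \<open>Traces of products of positive matrices\<close>

text \<open>Induction on the number of nonzero diagonal entries of \<open>W\<close>: each Schur step
  splits off a nonnegative value of the form of \<open>K\<close>, divided by a positive pivot, until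
  \<open>W\<close> is zero.\<close>

lemma trace_mult_psd_nonneg:
  fixes K W :: "complex^'n^'n"
  assumes K: "psd K" and "psd W"
  shows "0 \<le> Re (trace (K ** W))"
  using \<open>psd W\<close>
proof (induction "card {i. W $ i $ i \<noteq> 0}" arbitrary: W rule: less_induct)
  case less
  show ?case
  proof (cases "\<exists>a. W $ a $ a \<noteq> 0")
    case True
    then obtain a where a: "W $ a $ a \<noteq> 0" by blast
    obtain W' where W': "psd W'" "{i. W' $ i $ i \<noteq> 0} \<subset> {i. W $ i $ i \<noteq> 0}"
      and tr: "trace (K ** W) = trace (K ** W') + sesq K (W $ a) (W $ a) / of_real (Re (W $ a $ a))"
      and pos: "0 < Re (W $ a $ a)"
      by (rule schur_step[OF less.prems a])
    have "0 \<le> Re (trace (K ** W'))"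
      using less.hyps W' by (simp add: psubset_card_mono)
    moreover have "0 \<le> Re (sesq K (W $ a) (W $ a))" using K by (simp add: psd_def)
    ultimately show ?thesis using pos by (simp add: tr)
  next
    case False
    then have "W = 0" using psd_zero_diagonal[OF less.prems] by blast
    then show ?thesis by (simp add: trace_def matrix_matrix_mult_def)
  qed
qed

lemma trace_mult_positive_definite_pos:
  fixes K W :: "complex^'n^'n"
  assumes K: "positive_definite_matrix K" and W: "positive_definite_matrix W"
  shows "0 < Re (trace (K ** W))"
proof -
  \<comment> \<open>Any index can serve as pivot, since the diagonal of \<open>W\<close> is
    positive. One Schur step already gives a strictly positive term, and the rest of the trace is
    nonnegative.\<close>
  define a :: 'n where "a = undefined"
  have "axis a 1 \<noteq> (0 :: complex^'n)" by (simp add: axis_eq_0_iff)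
  then have Waa: "W $ a $ a \<noteq> 0"
    using W unfolding positive_definite_matrix_sesq
    by (metis less_irrefl sesq_axis zero_complex.simps(1))
  obtain W' where W': "psd W'" "{i. W' $ i $ i \<noteq> 0} \<subset> {i. W $ i $ i \<noteq> 0}"
    and tr: "trace (K ** W) = trace (K ** W') + sesq K (W $ a) (W $ a) / of_real (Re (W $ a $ a))"
    and pos: "0 < Re (W $ a $ a)"
    by (rule schur_step[OF positive_definite_imp_psd[OF W] Waa])
  have "W $ a \<noteq> 0" using Waa by (metis zero_index)
  then have "0 < Re (sesq K (W $ a) (W $ a))"
    using K by (simp add: positive_definite_matrix_sesq)
  moreover have "0 \<le> Re (trace (K ** W'))"
    by (rule trace_mult_psd_nonneg[OF positive_definite_imp_psd[OF K] W'(1)])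
  ultimately show ?thesis using pos by (simp add: tr add_nonneg_pos)
qed

text \<open>Conjugation transposes both factors, which only exchanges the two summations. Reality of
  the trace turns \<open>Re\<close> of the top-form quotient into a quotient of reals.\<close>

lemma trace_mult_hermitian_real:
  fixes K W :: "complex^'n^'n"
  assumes "hermitian_matrix K" "hermitian_matrix W"
  shows "trace (K ** W) \<in> \<real>"
proof -
  have "cnj (trace (K ** W)) = (\<Sum>i\<in>UNIV. \<Sum>k\<in>UNIV. K $ k $ i * W $ i $ k)"
    using assms by (simp add: trace_def matrix_matrix_mult_def hermitian_matrix_entry)
  also have "\<dots> = trace (K ** W)"
    unfolding trace_def matrix_matrix_mult_def by (simp, rule sum.swap)
  finally show ?thesis by (simp add: Reals_cnj_iff)
qed

section \<open>Inverses and reversal of the matrix order\<close>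

lemma sesq_vector_matrix: "sesq H u v = (\<Sum>j\<in>UNIV. (u v* H) $ j * cnj (v $ j))"
  unfolding sesq_def vector_matrix_mult_def
  by (subst sum.swap) (simp add: sum_distrib_left mult_ac)

text \<open>A kernel vector \<open>x\<close> of the transpose satisfies \<open>x v* H = 0\<close>,
  so the form of \<open>H\<close> would vanish at \<open>x\<close>.\<close>

lemma positive_definite_det_nonzero:
  fixes H :: "complex^'n^'n"
  assumes "positive_definite_matrix H"
  shows "det H \<noteq> 0"
proof -
  have "x = 0" if "transpose H *v x = 0" for x
  proof (rule ccontr)
    assume "x \<noteq> 0"
    then have "0 < Re (sesq H x x)" using assms by (simp add: positive_definite_matrix_sesq)
    moreover have "x v* H = 0" using that by simp
    ultimately show False by (simp add: sesq_vector_matrix)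
  qed
  then have "\<exists>B. B ** transpose H = mat 1"
    unfolding matrix_left_invertible_ker by blast
  then have "invertible (transpose H)"
    unfolding invertible_def using matrix_left_right_inverse by blast
  then show ?thesis by (simp add: invertible_det_nz)
qed

lemma matrix_inv_mult:
  fixes H :: "complex^'n^'n"
  assumes "det H \<noteq> 0"
  shows "matrix_inv H ** H = mat 1" "H ** matrix_inv H = mat 1"
proof -
  have "\<exists>B. H ** B = mat 1 \<and> B ** H = mat 1"
    using assms by (simp add: invertible_det_nz flip: invertible_def)
  from someI_ex[OF this]
  show "matrix_inv H ** H = mat 1" "H ** matrix_inv H = mat 1" by (simp_all add: matrix_inv_def)
qed

lemma vector_matrix_inv:
  fixes H :: "complex^'n^'n"
  assumes "det H \<noteq> 0"
  shows "(v v* matrix_inv H) v* H = v"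
  by (simp add: vector_matrix_mul_assoc matrix_inv_mult[OF assms])

text \<open>With \<open>p = u v* matrix_inv H\<close>, both sides are the sum of
  \<open>p $ j * cnj (v $ j)\<close>, because multiplying \<open>v v* matrix_inv H\<close> by
  \<open>H\<close> gives back \<open>v\<close>.\<close>

lemma sesq_matrix_inv:
  fixes H :: "complex^'n^'n"
  assumes "det H \<noteq> 0"
  shows "sesq (matrix_inv H) u v = cnj (sesq H (v v* matrix_inv H) (u v* matrix_inv H))"
  unfolding sesq_vector_matrix vector_matrix_inv[OF assms] by (simp add: mult.commute)

lemma positive_definite_matrix_inv:
  fixes H :: "complex^'n^'n"
  assumes H: "positive_definite_matrix H"
  shows "positive_definite_matrix (matrix_inv H)"
proof -
  have nz: "det H \<noteq> 0" by (rule positive_definite_det_nonzero[OF H])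
  have h: "hermitian_matrix H" using H by (simp add: positive_definite_matrix_def)
  have "hermitian_matrix (matrix_inv H)"
    by (rule hermitian_matrixI_sesq) (simp add: sesq_matrix_inv[OF nz] hermitian_sesq_cnj[OF h])
  moreover have "0 < Re (sesq (matrix_inv H) v v)" if "v \<noteq> 0" for v
  proof -
    have "v v* matrix_inv H \<noteq> 0"
      using vector_matrix_inv[OF nz, of v] that by (metis vector_matrix_mult_0)
    then show ?thesis
      using H by (simp add: sesq_matrix_inv[OF nz] positive_definite_matrix_sesq)
  qed
  ultimately show ?thesis by (simp add: positive_definite_matrix_sesq)
qed

text \<open>Put \<open>r1 = v v* matrix_inv H1\<close> and \<open>r2 = v v* matrix_inv H2\<close>.
  The mixed term \<open>sesq H2 r2 r1\<close> equals \<open>sesq H1 r1 r1\<close>, so nonnegativity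
  of \<open>H2\<close> at \<open>r2 - r1\<close> bounds the form of \<open>H2\<close> at
  \<open>r2\<close> below by twice that of \<open>H1\<close> at \<open>r1\<close> minus that of
  \<open>H2\<close> at \<open>r1\<close>. By \<open>le\<close> this is at least the form of
  \<open>H1\<close> at \<open>r1\<close>.\<close>

lemma psd_matrix_inv_diff:
  fixes H1 H2 :: "complex^'n^'n"
  assumes H1: "positive_definite_matrix H1" and H2: "positive_definite_matrix H2"
    and le: "\<And>v. Re (sesq H2 v v) \<le> Re (sesq H1 v v)"
  shows "psd (matrix_inv H2 - matrix_inv H1)"
  unfolding psd_def
proof (intro conjI allI)
  have nz: "det H1 \<noteq> 0" "det H2 \<noteq> 0"
    using H1 H2 positive_definite_det_nonzero by blast+
  have h: "hermitian_matrix H1" "hermitian_matrix H2"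
    using H1 H2 by (simp_all add: positive_definite_matrix_def)
  show "hermitian_matrix (matrix_inv H2 - matrix_inv H1)"
    using positive_definite_matrix_inv[OF H1] positive_definite_matrix_inv[OF H2]
    by (simp add: positive_definite_matrix_def hermitian_matrix_def[of "_ - _"] hermitian_matrix_entry)
  fix v
  let ?r1 = "v v* matrix_inv H1" and ?r2 = "v v* matrix_inv H2"
  have "sesq H2 ?r2 ?r1 = sesq H1 ?r1 ?r1"
    by (simp add: sesq_vector_matrix vector_matrix_inv[OF nz(1)] vector_matrix_inv[OF nz(2)])
  moreover have "Re (sesq H2 ?r1 ?r2) = Re (sesq H2 ?r2 ?r1)"
    by (metis hermitian_sesq_cnj[OF h(2)] complex_cnj(1) cnj.simps(1))
  moreover have "0 \<le> Re (sesq H2 (?r2 - ?r1) (?r2 - ?r1))"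
    using positive_definite_imp_psd[OF H2] by (simp add: psd_def)
  ultimately show "0 \<le> Re (sesq (matrix_inv H2 - matrix_inv H1) v v)"
    using le[of ?r1]
    by (simp add: sesq_matrix_diff sesq_matrix_inv[OF nz(1)] sesq_matrix_inv[OF nz(2)] sesq_expand)
qed

text \<open>The quotient is the dimension divided by the trace of \<open>matrix_inv H ** W\<close>,
  and this trace decreases in \<open>H\<close> because inversion reverses the order. Positivity is
  recorded so that \<open>ln\<close> can be applied to the inequality.\<close>

lemma top_quotient_mono:
  fixes W H1 H2 :: "complex^'n^'n"
  assumes W: "positive_definite_matrix W"
    and H1: "positive_definite_matrix H1" and H2: "positive_definite_matrix H2"
    and le: "\<And>v. Re (sesq H2 v v) \<le> Re (sesq H1 v v)"
  shows "0 < Re (power_top H2 / wedge_power_top W H2)"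
    and "Re (power_top H2 / wedge_power_top W H2) \<le> Re (power_top H1 / wedge_power_top W H1)"
proof -
  let ?t = "\<lambda>H. Re (trace (matrix_inv H ** W))"
  have hW: "hermitian_matrix W" using W by (simp add: positive_definite_matrix_def)
  have eq: "Re (power_top H / wedge_power_top W H) = real CARD('n) / ?t H" and pos: "0 < ?t H"
    if H: "positive_definite_matrix H" for H :: "complex^'n^'n"
  proof -
    have "trace (matrix_inv H ** W) \<in> \<real>"
      using positive_definite_matrix_inv[OF H] hW
      by (intro trace_mult_hermitian_real) (simp_all add: positive_definite_matrix_def)
    then obtain r where r: "trace (matrix_inv H ** W) = of_real r" by (rule Reals_cases)
    show "Re (power_top H / wedge_power_top W H) = real CARD('n) / ?t H"
      unfolding top_quotient_eq[OF positive_definite_det_nonzero[OF H]] r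
      by (metis Re_complex_of_real of_real_divide of_real_of_nat_eq)
    show "0 < ?t H"
      by (rule trace_mult_positive_definite_pos[OF positive_definite_matrix_inv[OF H] W])
  qed
  have "0 \<le> Re (trace ((matrix_inv H2 - matrix_inv H1) ** W))"
    by (rule trace_mult_psd_nonneg[OF psd_matrix_inv_diff[OF H1 H2 le] positive_definite_imp_psd[OF W]])
  then have "?t H1 \<le> ?t H2"
    by (simp add: trace_def matrix_matrix_mult_def sum_subtractf left_diff_distrib)
  then show "Re (power_top H2 / wedge_power_top W H2) \<le> Re (power_top H1 / wedge_power_top W H1)"
    using pos[OF H1] by (simp add: eq H1 H2 divide_left_mono)
  show "0 < Re (power_top H2 / wedge_power_top W H2)"
    using pos[OF H2] by (simp add: eq H2)
qed

section \<open>Second derivatives and the Levi form\<close>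

text \<open>For a set \<open>S\<close> that need not be open, since it is applied to a cylinder
  containing the initial time. Near each point \<open>f\<close> agrees on \<open>S\<close> with a
  continuous local extension.\<close>

lemma smooth_on_imp_continuous_on:
  fixes f :: "'a::real_normed_vector \<Rightarrow> 'b::real_normed_vector"
  assumes "smooth_on S f"
  shows "continuous_on S f"
  unfolding continuous_on_eq_continuous_within
proof
  fix x assume x: "x \<in> S"
  then obtain W g where W: "open W" "x \<in> W" and g: "\<And>k. Ck_on k g W"
    and eq: "\<And>y. y \<in> S \<inter> W \<Longrightarrow> f y = g y"
    using assms unfolding smooth_on_def by metis
  have "continuous_on W g" using g[of 0] by simp
  then have "continuous (at x within S) g"
    using W by (meson continuous_at_imp_continuous_at_within continuous_on_eq_continuous_at)
  moreover have "openin (top_of_set S) (S \<inter> W)"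
    using W(1) by (rule openin_open_Int)
  ultimately show "continuous (at x within S) f"
    using continuous_transform_within_openin[of x S g "S \<inter> W" f] x W(2) eq by simp
qed

definition twice_differentiable_on ::
    "('a::real_normed_vector \<Rightarrow> 'b::real_normed_vector) \<Rightarrow> 'a set \<Rightarrow> bool" where
  "twice_differentiable_on f S \<longleftrightarrow>
     (\<forall>x\<in>S. f differentiable (at x)) \<and>
     (\<forall>x\<in>S. \<forall>v. (\<lambda>z. frechet_derivative f (at z) v) differentiable (at x))"

lemma frechet_derivative_transform_open:
  assumes "open W" "x \<in> W" "\<And>y. y \<in> W \<Longrightarrow> f y = g y"
  shows "frechet_derivative f (at x) = frechet_derivative g (at x)"
proof -
  have "(f has_derivative D) (at x) \<longleftrightarrow> (g has_derivative D) (at x)" for D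
    using assms has_derivative_transform_within_open by metis
  then show ?thesis by (simp add: frechet_derivative_def)
qed

lemma differentiable_transform_open:
  assumes "open W" "x \<in> W" "\<And>y. y \<in> W \<Longrightarrow> f y = g y" "g differentiable (at x)"
  shows "f differentiable (at x)"
  using assms has_derivative_transform_within_open unfolding differentiable_def by metis

lemma smooth_on_imp_twice_differentiable_on:
  assumes "smooth_on S f" "open S"
  shows "twice_differentiable_on f S"
  unfolding twice_differentiable_on_def
proof (intro conjI ballI allI)
  fix x assume x: "x \<in> S"
  then obtain W g where W: "open W" "x \<in> W" and g: "\<And>k. Ck_on k g W"
    and eq: "\<And>y. y \<in> S \<inter> W \<Longrightarrow> f y = g y"
    using assms(1) unfolding smooth_on_def by metis
  have g2: "Ck_on (Suc (Suc 0)) g W" by (rule g)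
  have op: "open (S \<inter> W)" "x \<in> S \<inter> W" using assms(2) W x by auto
  have "g differentiable (at x)" using g2 W(2) by simp
  then show "f differentiable (at x)"
    using differentiable_transform_open[OF op] eq by blast
  fix v
  have "(\<lambda>z. frechet_derivative g (at z) v) differentiable (at x)" using g2 W(2) by simp
  then show "(\<lambda>z. frechet_derivative f (at z) v) differentiable (at x)"
  proof (rule differentiable_transform_open[OF op, rotated])
    fix y assume "y \<in> S \<inter> W"
    then show "frechet_derivative f (at y) v = frechet_derivative g (at y) v"
      using frechet_derivative_transform_open[OF op(1), of y f g] eq by simp
  qed
qed

section \<open>Second directional derivatives\<close>

definition hess :: "('a::real_normed_vector \<Rightarrow> 'b::real_normed_vector) \<Rightarrow> 'a \<Rightarrow> 'a \<Rightarrow> 'a \<Rightarrow> 'b" where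
  "hess f z u v = frechet_derivative (\<lambda>y. frechet_derivative f (at y) v) (at z) u"

lemma hess_has_derivative:
  assumes "twice_differentiable_on f S" "z \<in> S"
  shows "((\<lambda>y. frechet_derivative f (at y) v) has_derivative (\<lambda>u. hess f z u v)) (at z)"
  using assms unfolding twice_differentiable_on_def hess_def
  by (simp add: frechet_derivative_works[symmetric])

lemma hess_linear_left:
  assumes "twice_differentiable_on f S" "z \<in> S"
  shows "linear (\<lambda>u. hess f z u v)"
  using hess_has_derivative[OF assms] has_derivative_linear by blast

text \<open>The first derivative is linear in its direction at every point of the open set
  \<open>S\<close>; differentiating this identity at \<open>z\<close> and using uniqueness of
  derivatives gives linearity in \<open>v\<close>.\<close>

lemma hess_linear_right:
  assumes f: "twice_differentiable_on f S" and S: "open S" and z: "z \<in> S"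
  shows "linear (\<lambda>v. hess f z u v)"
proof (rule linearI)
  note D = hess_has_derivative[OF f z]
  have lin: "linear (frechet_derivative f (at y))" if "y \<in> S" for y
    using f that by (intro linear_frechet_derivative) (simp add: twice_differentiable_on_def)
  fix v w :: 'a and r :: real
  have "((\<lambda>y. frechet_derivative f (at y) (v + w)) has_derivative (\<lambda>u. hess f z u v + hess f z u w)) (at z)"
    by (rule has_derivative_transform_within_open[OF has_derivative_add[OF D D] S z])
       (simp add: linear_add[OF lin])
  from has_derivative_unique[OF this D]
  show "hess f z u (v + w) = hess f z u v + hess f z u w" by metis
  have "((\<lambda>y. frechet_derivative f (at y) (r *\<^sub>R v)) has_derivative (\<lambda>u. r *\<^sub>R hess f z u v)) (at z)"
    by (rule has_derivative_transform_within_open[OF has_derivative_scaleR_right[OF D] S z])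
       (simp add: linear_scale[OF lin])
  from has_derivative_unique[OF this D]
  show "hess f z u (r *\<^sub>R v) = r *\<^sub>R hess f z u v" by metis
qed

text \<open>If \<open>l\<close> were negative, \<open>h'\<close> would vanish at 0 and be negative
  just to the right of it; by the mean value theorem \<open>h\<close> would drop below
  \<open>h 0\<close>.\<close>

lemma second_derivative_test_min:
  fixes h :: "real \<Rightarrow> real"
  assumes d: "0 < d"
    and h': "\<And>t. \<bar>t\<bar> < d \<Longrightarrow> (h has_real_derivative h' t) (at t)"
    and h'': "(h' has_real_derivative l) (at 0)"
    and min: "\<And>t. \<bar>t\<bar> < d \<Longrightarrow> h 0 \<le> h t"
  shows "0 \<le> l"
proof (rule ccontr)
  assume "\<not> 0 \<le> l"
  have "h' 0 = 0"
    using DERIV_local_min[OF h'[of 0] d] min d by simp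
  moreover obtain e where e: "e > 0" "\<And>s. 0 < s \<Longrightarrow> s < e \<Longrightarrow> h' s < h' 0"
    using DERIV_neg_dec_right[OF h''] \<open>\<not> 0 \<le> l\<close> by auto
  ultimately have neg: "\<And>s. 0 < s \<Longrightarrow> s < e \<Longrightarrow> h' s < 0" by metis
  define t where "t = min d e / 2"
  have t: "0 < t" "t < d" "t < e" using d e(1) by (auto simp: t_def)
  obtain s where s: "0 < s" "s < t" "h t - h 0 = (t - 0) * h' s"
    using MVT2[OF t(1), of h h'] h' t by auto
  have "h t - h 0 < 0"
    using s neg[of s] t by (simp add: mult_pos_neg)
  then show False using min[of t] t by simp
qed

text \<open>The one-variable test is applied to \<open>f - g\<close> along the line through
  \<open>z\<close> in direction \<open>v\<close>.\<close>

lemma hess_le_at_local_min: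
  fixes f g :: "'a::real_normed_vector \<Rightarrow> real"
  assumes f: "twice_differentiable_on f S" and g: "twice_differentiable_on g S"
    and S: "open S" and z: "z \<in> S"
    and min: "\<And>y. y \<in> S \<Longrightarrow> f z - g z \<le> f y - g y"
  shows "hess g z v v \<le> hess f z v v"
proof -
  let ?p = "\<lambda>t. z + t *\<^sub>R v"
  have "open (?p -` S)"
    by (intro open_vimage S continuous_intros)
  moreover have "0 \<in> ?p -` S" using z by simp
  ultimately obtain d where d: "d > 0" "ball 0 d \<subseteq> ?p -` S"
    using open_contains_ball by metis
  have inS: "?p t \<in> S" if "\<bar>t\<bar> < d" for t
    using d(2) that by (auto simp: subset_iff)
  have p: "(?p has_derivative (\<lambda>s. s *\<^sub>R v)) (at t)" for t
    by (auto intro!: derivative_eq_intros)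
  have line: "((\<lambda>t. k (?p t)) has_real_derivative K v) (at t)"
    if "(k has_derivative K) (at (?p t))" for k :: "'a \<Rightarrow> real" and K t
  proof -
    have "((\<lambda>t. k (?p t)) has_derivative (\<lambda>s. K (s *\<^sub>R v))) (at t)"
      using has_derivative_compose[OF p that] .
    moreover have "(\<lambda>s. K (s *\<^sub>R v)) = (*) (K v)"
      using linear_scale[OF has_derivative_linear[OF that]] by (simp add: fun_eq_iff)
    ultimately show ?thesis by (simp add: has_field_derivative_def)
  qed
  have "0 \<le> hess f z v v - hess g z v v"
  proof (rule second_derivative_test_min[OF d(1)])
    show "((\<lambda>t. f (?p t) - g (?p t)) has_real_derivative
        frechet_derivative f (at (?p t)) v - frechet_derivative g (at (?p t)) v) (at t)"
      if "\<bar>t\<bar> < d" for t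
      using f g inS[OF that] unfolding twice_differentiable_on_def
      by (intro DERIV_diff line) (simp_all add: frechet_derivative_works[symmetric])
    show "((\<lambda>t. frechet_derivative f (at (?p t)) v - frechet_derivative g (at (?p t)) v)
        has_real_derivative hess f z v v - hess g z v v) (at 0)"
      using hess_has_derivative[OF f z, of v] hess_has_derivative[OF g z, of v]
      by (intro DERIV_diff line) simp_all
  qed (use min inS in auto)
  then show ?thesis by simp
qed

section \<open>The complex Hessian in real coordinates\<close>

lemma vec_complex_expansion:
  fixes v :: "complex^'n"
  shows "v = (\<Sum>j\<in>UNIV. Re (v $ j) *\<^sub>R axis j 1 + Im (v $ j) *\<^sub>R axis j \<i>)"
proof -
  have "(\<Sum>j\<in>UNIV. Re (v $ j) *\<^sub>R axis j 1 + Im (v $ j) *\<^sub>R axis j \<i>) $ k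
      = (\<Sum>j\<in>UNIV. if j = k then v $ k else 0)" for k
    unfolding sum_component
    by (intro sum.cong) (auto simp: axis_def complex_eq_iff)
  then show ?thesis by (simp add: vec_eq_iff)
qed

lemma has_derivative_imp_frechet: "(f has_derivative D) (at x) \<Longrightarrow> frechet_derivative f (at x) = D"
  using frechet_derivative_at by metis

lemma d_z_d_zbar_of_real:
  fixes f :: "complex^'n \<Rightarrow> real"
  assumes f: "twice_differentiable_on f S" and S: "open S" and z: "z \<in> S"
  shows "d_z j (d_zbar k (\<lambda>y. complex_of_real (f y))) z =
    (of_real (hess f z (axis j 1) (axis k 1) + hess f z (axis j \<i>) (axis k \<i>))
      + \<i> * of_real (hess f z (axis j 1) (axis k \<i>) - hess f z (axis j \<i>) (axis k 1))) / 4"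
proof -
  let ?D = "\<lambda>v y. frechet_derivative f (at y) v"
  \<comment> \<open>Shown on all of \<open>S\<close>, not only at \<open>z\<close>, so that it can
    be differentiated once more.\<close>
  have 1: "d_zbar k (\<lambda>y. complex_of_real (f y)) y
      = (of_real (?D (axis k 1) y) + \<i> * of_real (?D (axis k \<i>) y)) / 2" if "y \<in> S" for y
  proof -
    have "(f has_derivative frechet_derivative f (at y)) (at y)"
      using f that by (simp add: twice_differentiable_on_def frechet_derivative_works[symmetric])
    then have "((\<lambda>y. complex_of_real (f y)) has_derivative (\<lambda>u. of_real (?D u y))) (at y)"
      by (rule has_derivative_of_real)
    from has_derivative_imp_frechet[OF this] show ?thesis by (simp add: d_zbar_def)
  qed
  have "((\<lambda>y. 1 / 2 * (complex_of_real (?D (axis k 1) y) + \<i> * of_real (?D (axis k \<i>) y))) has_derivative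
       (\<lambda>u. 1 / 2 * (of_real (hess f z u (axis k 1)) + \<i> * of_real (hess f z u (axis k \<i>))))) (at z)"
    by (intro has_derivative_mult_right has_derivative_add has_derivative_of_real hess_has_derivative[OF f z])
  then have "(d_zbar k (\<lambda>y. complex_of_real (f y)) has_derivative
       (\<lambda>u. 1 / 2 * (of_real (hess f z u (axis k 1)) + \<i> * of_real (hess f z u (axis k \<i>))))) (at z)"
    by (rule has_derivative_transform_within_open[OF _ S z]) (simp add: 1)
  from has_derivative_imp_frechet[OF this] show ?thesis
    by (simp add: d_z_def field_simps)
qed

text \<open>Reduces the complex Hessian to the real one on the directions \<open>v\<close> and
  \<open>\<i> *s v\<close>, where the real second derivative test applies. In real coordinates the
  two sides agree for each pair of indices separately.\<close>

lemma levi_form_eq: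
  fixes f :: "complex^'n \<Rightarrow> real"
  assumes f: "twice_differentiable_on f S" and S: "open S" and z: "z \<in> S"
  shows "Re (\<Sum>j\<in>UNIV. \<Sum>k\<in>UNIV. d_z j (d_zbar k (\<lambda>y. complex_of_real (f y))) z * v $ j * cnj (v $ k))
    = (hess f z v v + hess f z (\<i> *s v) (\<i> *s v)) / 4"
proof -
  note l = hess_linear_left[OF f z] and r = hess_linear_right[OF f S z]
  have expand: "hess f z w w = (\<Sum>j\<in>UNIV. \<Sum>k\<in>UNIV.
        Re (w $ j) * (Re (w $ k) * hess f z (axis j 1) (axis k 1) + Im (w $ k) * hess f z (axis j 1) (axis k \<i>))
      + Im (w $ j) * (Re (w $ k) * hess f z (axis j \<i>) (axis k 1) + Im (w $ k) * hess f z (axis j \<i>) (axis k \<i>)))"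
    for w
  proof -
    let ?e = "\<lambda>j. Re (w $ j) *\<^sub>R axis j 1 + Im (w $ j) *\<^sub>R axis j \<i>"
    have we: "w = (\<Sum>j\<in>UNIV. ?e j)" by (rule vec_complex_expansion)
    \<comment> \<open>The variable \<open>w\<close> occurs on both sides of \<open>we\<close>; it is
      therefore replaced in one argument at a time instead of by rewriting.\<close>
    have "hess f z w w = hess f z (\<Sum>j\<in>UNIV. ?e j) w"
      by (rule arg_cong[OF we])
    also have "\<dots> = (\<Sum>j\<in>UNIV. hess f z (?e j) w)"
      by (rule linear_sum[OF l])
    also have "\<dots> = (\<Sum>j\<in>UNIV. \<Sum>k\<in>UNIV. hess f z (?e j) (?e k))"
    proof (intro sum.cong refl)
      fix j
      have "hess f z (?e j) w = hess f z (?e j) (\<Sum>k\<in>UNIV. ?e k)"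
        by (rule arg_cong[OF we])
      also have "\<dots> = (\<Sum>k\<in>UNIV. hess f z (?e j) (?e k))"
        by (rule linear_sum[OF r])
      finally show "hess f z (?e j) w = (\<Sum>k\<in>UNIV. hess f z (?e j) (?e k))" .
    qed
    also have "\<dots> = (\<Sum>j\<in>UNIV. \<Sum>k\<in>UNIV.
        Re (w $ j) * (Re (w $ k) * hess f z (axis j 1) (axis k 1) + Im (w $ k) * hess f z (axis j 1) (axis k \<i>))
      + Im (w $ j) * (Re (w $ k) * hess f z (axis j \<i>) (axis k 1) + Im (w $ k) * hess f z (axis j \<i>) (axis k \<i>)))"
      by (intro sum.cong refl)
         (simp add: linear_add[OF l] linear_add[OF r] linear_scale[OF l] linear_scale[OF r] algebra_simps)
    finally show ?thesis .
  qed
  show ?thesis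
    unfolding expand d_z_d_zbar_of_real[OF f S z]
    unfolding Re_sum sum.distrib[symmetric] sum_divide_distrib
    by (intro sum.cong refl) (simp add: field_simps)
qed

section \<open>Monotonicity of the operator at a minimum\<close>

lemma is_chart_continuous_map:
  "is_chart M c \<Longrightarrow> continuous_map (subtopology M (dom_chart c)) (top_of_set (img_chart c)) (snd c)"
  by (simp add: is_chart_def homeomorphic_imp_continuous_map)

lemma is_chart_inv_chart:
  assumes "is_chart M c" "x \<in> dom_chart c"
  shows "inv_chart c (snd c x) = x"
proof -
  have "openin M (dom_chart c)"
    and hom: "homeomorphic_map (subtopology M (dom_chart c)) (top_of_set (img_chart c)) (snd c)"
    using assms(1) by (auto simp: is_chart_def)
  then have "inj_on (snd c) (dom_chart c)"
    using homeomorphic_imp_injective_map[OF hom] by (simp add: Int_absorb1 openin_subset)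
  then show ?thesis using assms(2) by simp
qed

text \<open>A minimum over \<open>M\<close> is a minimum over the chart image, so the real Hessians
  compare in the directions \<open>v\<close> and \<open>\<i> *s v\<close>; the sum is the Levi
  form.\<close>

lemma levi_form_le_at_minimum:
  fixes c :: "('a, 'n::finite) chart"
  assumes c: "c \<in> A" "is_chart M c"
    and \<phi>: "smooth_function A \<phi>" and \<psi>: "smooth_function A \<psi>"
    and x: "x \<in> dom_chart c"
    and min: "\<And>y. y \<in> topspace M \<Longrightarrow> \<phi> x - \<psi> x \<le> \<phi> y - \<psi> y"
  shows "Re (sesq (i_ddbar \<psi> c x) v v) \<le> Re (sesq (i_ddbar \<phi> c x) v v)"
proof -
  let ?S = "img_chart c" and ?z = "snd c x"
  have S: "open ?S" and sub: "dom_chart c \<subseteq> topspace M"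
    using c(2) openin_subset by (auto simp: is_chart_def)
  have z: "?z \<in> ?S" using x by simp
  have inv: "inv_chart c ?z = x" by (rule is_chart_inv_chart[OF c(2) x])
  have into: "inv_chart c y \<in> topspace M" if "y \<in> ?S" for y
    using inv_into_into[OF that] sub by blast
  have diff: "twice_differentiable_on (\<phi> \<circ> inv_chart c) ?S" "twice_differentiable_on (\<psi> \<circ> inv_chart c) ?S"
    using \<phi> \<psi> c(1) S by (auto simp: smooth_function_def intro: smooth_on_imp_twice_differentiable_on)
  have eq: "Re (sesq (i_ddbar \<theta> c x) v v) =
      (hess (\<theta> \<circ> inv_chart c) ?z v v + hess (\<theta> \<circ> inv_chart c) ?z (\<i> *s v) (\<i> *s v)) / 4"
    if "twice_differentiable_on (\<theta> \<circ> inv_chart c) ?S" for \<theta> :: "'a \<Rightarrow> real"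
    using levi_form_eq[OF that S z, of v] by (simp add: sesq_def i_ddbar_def)
  have "hess (\<psi> \<circ> inv_chart c) ?z w w \<le> hess (\<phi> \<circ> inv_chart c) ?z w w" for w
    using into by (intro hess_le_at_local_min[OF diff S z]) (simp add: inv min)
  from add_mono[OF this[of v] this[of "\<i> *s v"]] show ?thesis
    by (simp add: eq diff)
qed

lemma Q_op_mono_at_minimum:
  fixes A :: "('a, 'n::finite) chart set"
  assumes M: "complex_manifold M A" and \<omega>: "hermitian_metric A \<omega>"
    and \<phi>: "\<phi> \<in> admissible_potentials A chi" and \<psi>: "\<psi> \<in> admissible_potentials A chi"
    and x: "x \<in> topspace M"
    and min: "\<And>y. y \<in> topspace M \<Longrightarrow> \<phi> x - \<psi> x \<le> \<phi> y - \<psi> y"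
  shows "Q_op A \<omega> chi F \<psi> x \<le> Q_op A \<omega> chi F \<phi> x"
proof -
  \<comment> \<open>The chart chosen inside \<open>Q_op\<close>; it depends only on
    \<open>x\<close>, so both potentials are compared in the same coordinates.\<close>
  define c where "c = (SOME c. c \<in> A \<and> x \<in> dom_chart c)"
  have "\<exists>c. c \<in> A \<and> x \<in> dom_chart c"
    using M x unfolding complex_manifold_def by blast
  then have c: "c \<in> A" "x \<in> dom_chart c"
    unfolding c_def by (metis (mono_tags, lifting) someI_ex)+
  have chart: "is_chart M c" using M c(1) by (simp add: complex_manifold_def)
  let ?H = "\<lambda>\<theta>. perturbed_form chi \<theta> c x"
  have pos: "positive_definite_matrix (\<omega> c x)" "positive_definite_matrix (?H \<phi>)"
      "positive_definite_matrix (?H \<psi>)"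
    using \<omega> \<phi> \<psi> c by (auto simp: hermitian_metric_def admissible_potentials_def positive_form11_def)
  have "Re (sesq (?H \<psi>) v v) \<le> Re (sesq (?H \<phi>) v v)" for v
    using levi_form_le_at_minimum[where \<phi> = \<phi> and \<psi> = \<psi>, OF c(1) chart _ _ c(2) min, of v] \<phi> \<psi>
    by (simp add: perturbed_form_def sesq_matrix_add admissible_potentials_def)
  from top_quotient_mono[OF pos this] show ?thesis
    by (simp add: Q_op_def Let_def c_def[symmetric])
qed

section \<open>The maximum principle\<close>

lemma compact_space_attains_min:
  fixes f :: "'a \<Rightarrow> real"
  assumes "compact_space X" "continuous_map X euclideanreal f" "topspace X \<noteq> {}"
  obtains x where "x \<in> topspace X" "\<forall>y\<in>topspace X. f x \<le> f y"
proof -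
  have "compactin euclideanreal (f ` topspace X)"
    using assms(1,2) by (intro image_compactin) (simp_all add: compact_space_def)
  then have "compact (f ` topspace X)" by simp
  then obtain m where "m \<in> f ` topspace X" "\<forall>y\<in>f ` topspace X. m \<le> y"
    using compact_attains_inf assms(3) by (metis image_is_empty)
  then show ?thesis using that by auto
qed

text \<open>Here \<open>w\<close> is the time derivative of \<open>v\<close>, and its sign is
  required only at spatial minima, where the operators can be compared. Adding a small multiple of
  time makes the derivative strictly positive there.\<close>

lemma parabolic_minimum_principle:
  fixes v w :: "'a \<Rightarrow> real \<Rightarrow> real"
  assumes M: "compact_space M"
    and cont: "continuous_map (prod_topology M (top_of_set {0..T})) euclideanreal (\<lambda>(x, t). v x t)"
    and deriv: "\<And>x t. x \<in> topspace M \<Longrightarrow> 0 < t \<Longrightarrow> t \<le> T \<Longrightarrow>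
        (v x has_real_derivative w x t) (at t within {0..T})"
    and supersol: "\<And>x t. x \<in> topspace M \<Longrightarrow> 0 < t \<Longrightarrow> t \<le> T \<Longrightarrow>
        (\<And>y. y \<in> topspace M \<Longrightarrow> v x t \<le> v y t) \<Longrightarrow> 0 \<le> w x t"
    and init: "\<And>x. x \<in> topspace M \<Longrightarrow> m \<le> v x 0"
    and x: "x \<in> topspace M" and t: "0 \<le> t" "t \<le> T"
  shows "m \<le> v x t"
proof (rule ccontr)
  assume less: "\<not> m \<le> v x t"
  then have "t > 0" using init[OF x] t(1) by (cases "t = 0") auto
  \<comment> \<open>With this choice \<open>v x t + e * t\<close> is the midpoint of
    \<open>m\<close> and \<open>v x t\<close>, still below \<open>m\<close>.\<close>
  define e where "e = (m - v x t) / (2 * t)"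
  have e: "e > 0" and et: "v x t + e * t < m"
    using less \<open>t > 0\<close> by (simp_all add: e_def field_simps)
  let ?X = "prod_topology M (top_of_set {0..T})"
  have cX: "compact_space ?X"
    using M by (simp add: compact_space_prod_topology compact_space_subtopology)
  have "continuous_map ?X euclideanreal (\<lambda>p. (case p of (x, t) \<Rightarrow> v x t) + e * snd p)"
    by (intro continuous_map_add cont continuous_map_real_mult continuous_map_canonical_const
        continuous_map_into_fulltopology[OF continuous_map_snd])
  moreover have "topspace ?X \<noteq> {}" using x t by auto
  ultimately obtain p where p: "p \<in> topspace ?X"
    and min: "\<forall>q\<in>topspace ?X. (case p of (x, t) \<Rightarrow> v x t) + e * snd p \<le> (case q of (x, t) \<Rightarrow> v x t) + e * snd q"
    by (rule compact_space_attains_min[OF cX])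
  obtain y s where ys: "p = (y, s)" by (cases p)
  have y: "y \<in> topspace M" and s: "0 \<le> s" "s \<le> T" using p ys by auto
  have min': "v y s + e * s \<le> v y' s' + e * s'" if "y' \<in> topspace M" "0 \<le> s'" "s' \<le> T" for y' s'
    using bspec[OF min, of "(y', s')"] that ys by simp
  \<comment> \<open>At time 0 the perturbed function is at least \<open>m\<close>, but its minimum
    is below \<open>m\<close>.\<close>
  have "s \<noteq> 0"
    using min'[OF x t] et init[OF y] by auto
  then have "s > 0" using s by simp
  \<comment> \<open>At the fixed time \<open>s\<close> the term \<open>e * s\<close> is constant, so
    \<open>y\<close> is a spatial minimum of \<open>v\<close> itself.\<close>
  have "0 \<le> w y s"
    by (rule supersol[OF y \<open>s > 0\<close> s(2)]) (use min' s in force)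
  moreover have "((\<lambda>s. v y s + e * s) has_real_derivative w y s + e * 1) (at s within {0..T})"
    by (intro DERIV_add deriv y \<open>s > 0\<close> s DERIV_cmult DERIV_ident)
  \<comment> \<open>Only earlier times are compared, so the derivative within \<open>{0..T}\<close>
    suffices even at \<open>s = T\<close>.\<close>
  ultimately obtain d where d: "d > 0"
    "\<And>h. 0 < h \<Longrightarrow> s - h \<in> {0..T} \<Longrightarrow> h < d \<Longrightarrow> v y (s - h) + e * (s - h) < v y s + e * s"
    using has_real_derivative_pos_inc_left[of "\<lambda>s. v y s + e * s" "w y s + e * 1"] e by force
  define h where "h = min d s / 2"
  have "0 < h" "h < d" "h < s" using d(1) \<open>s > 0\<close> by (auto simp: h_def)
  then show False using d(2)[of h] min'[OF y, of "s - h"] s by force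
qed

section \<open>Continuity on the manifold and on the space-time cylinder\<close>

lemma smooth_function_continuous_map:
  fixes A :: "('a, 'n::finite) chart set"
  assumes M: "complex_manifold M A" and f: "smooth_function A f"
  shows "continuous_map M euclideanreal f"
proof (rule pasting_lemma[where I = A and T = dom_chart and f = "\<lambda>_. f"])
  fix c assume c: "c \<in> A"
  have chart: "is_chart M c" using M c by (simp add: complex_manifold_def)
  then show "openin M (dom_chart c)" by (simp add: is_chart_def)
  have "continuous_map (top_of_set (img_chart c)) euclideanreal (f \<circ> inv_chart c)"
    using f c smooth_on_imp_continuous_on unfolding smooth_function_def continuous_map_iff_continuous by blast
  from continuous_map_compose[OF is_chart_continuous_map[OF chart] this]
  show "continuous_map (subtopology M (dom_chart c)) euclideanreal f"
    by (rule continuous_map_eq) (simp add: is_chart_inv_chart[OF chart])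
next
  fix x assume "x \<in> topspace M"
  then show "\<exists>c. c \<in> A \<and> x \<in> dom_chart c \<and> f x = f x"
    using M unfolding complex_manifold_def by blast
qed simp

text \<open>Joint continuity allows a minimum to be taken over space and time together. It is pasted
  from the sets \<open>dom_chart c \<times> J\<close>, on which the function factors through the
  chart.\<close>

lemma smooth_on_cylinder_continuous_map:
  fixes A :: "('a, 'n::finite) chart set"
  assumes M: "complex_manifold M A" and \<phi>: "smooth_on_cylinder A T \<phi>" and J: "J \<subseteq> time_interval T"
  shows "continuous_map (prod_topology M (top_of_set J)) euclideanreal (\<lambda>(x, t). \<phi> x t)"
proof (rule pasting_lemma[where I = A and T = "\<lambda>c. dom_chart c \<times> J" and f = "\<lambda>_ (x, t). \<phi> x t"])
  fix c assume c: "c \<in> A"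
  have chart: "is_chart M c" using M c by (simp add: complex_manifold_def)
  then show "openin (prod_topology M (top_of_set J)) (dom_chart c \<times> J)"
    by (simp add: is_chart_def openin_prod_Times_iff)
  let ?G = "\<lambda>(y, t). \<phi> (inv_chart c y) t"
  have "continuous_on (img_chart c \<times> J) ?G"
  proof (rule continuous_on_subset)
    show "continuous_on (img_chart c \<times> time_interval T) ?G"
      using \<phi> c unfolding smooth_on_cylinder_def by (intro smooth_on_imp_continuous_on) blast
  qed (use J in blast)
  then have G: "continuous_map (prod_topology (top_of_set (img_chart c)) (top_of_set J)) euclideanreal ?G"
    by simp
  have "continuous_map (prod_topology (subtopology M (dom_chart c)) (top_of_set J))
      (prod_topology (top_of_set (img_chart c)) (top_of_set J)) (\<lambda>(x, t). (snd c x, t))"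
    using is_chart_continuous_map[OF chart] by (simp only: continuous_map_prod_top) simp
  from continuous_map_compose[OF this G]
  have "continuous_map (prod_topology (subtopology M (dom_chart c)) (top_of_set J)) euclideanreal
      (\<lambda>(x, t). \<phi> x t)"
    by (rule continuous_map_eq) (auto simp: is_chart_inv_chart[OF chart])
  then show "continuous_map (subtopology (prod_topology M (top_of_set J)) (dom_chart c \<times> J))
      euclideanreal (\<lambda>(x, t). \<phi> x t)"
    by (simp add: subtopology_Times subtopology_subtopology)
next
  fix p assume p: "p \<in> topspace (prod_topology M (top_of_set J))"
  then have "fst p \<in> (\<Union>c\<in>A. dom_chart c)"
    using M by (auto simp: complex_manifold_def)
  with p show "\<exists>c. c \<in> A \<and> p \<in> dom_chart c \<times> J \<and> (case p of (x, t) \<Rightarrow> \<phi> x t) = (case p of (x, t) \<Rightarrow> \<phi> x t)"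
    by (cases p) auto
qed simp

lemma compact_space_bounded:
  fixes f :: "'a \<Rightarrow> real"
  assumes "compact_space X" "continuous_map X euclideanreal f"
  obtains b where "\<forall>x\<in>topspace X. \<bar>f x\<bar> \<le> b"
proof -
  have "compactin euclideanreal (f ` topspace X)"
    using assms by (intro image_compactin) (simp_all add: compact_space_def)
  then have "bounded (f ` topspace X)" by (simp add: compact_imp_bounded)
  then show ?thesis using that by (auto simp: bounded_iff)
qed

section \<open>Comparison along the flow\<close>

text \<open>The minimum principle is used on the compact interval \<open>{0..t}\<close> for each
  \<open>t\<close>; since \<open>m\<close> comes from the initial time alone, the bounds are uniform
  in \<open>t\<close>, also for infinite \<open>T\<close>.\<close>

lemma flow_comparison:
  fixes A :: "('a, 'n::finite) chart set"
  assumes M: "complex_manifold M A" "compact_space M" and \<omega>: "hermitian_metric A \<omega>"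
    and sol: "flow_solution M A \<omega> chi F \<phi>0 T \<phi>"
    and \<psi>: "\<psi> \<in> admissible_potentials A chi"
    and t: "t \<in> time_interval T" and x: "x \<in> topspace M"
  shows flow_lower_bound: "\<lbrakk>\<And>y. y \<in> topspace M \<Longrightarrow> lam \<le> Q_op A \<omega> chi F \<psi> y;
       \<And>y. y \<in> topspace M \<Longrightarrow> m \<le> \<phi>0 y - \<psi> y\<rbrakk> \<Longrightarrow> \<psi> x + m \<le> \<phi> x t - lam * t"
    and flow_upper_bound: "\<lbrakk>\<And>y. y \<in> topspace M \<Longrightarrow> Q_op A \<omega> chi F \<psi> y \<le> lam;
       \<And>y. y \<in> topspace M \<Longrightarrow> \<phi>0 y - \<psi> y \<le> m\<rbrakk> \<Longrightarrow> \<phi> x t - lam * t \<le> \<psi> x + m"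
proof -
  have t0: "0 \<le> t" and J: "{0..t} \<subseteq> time_interval T"
    using t by (auto simp: time_interval_def intro: le_less_trans[of _ "ereal t"])
  let ?X = "prod_topology M (top_of_set {0..t})"
  have smooth: "smooth_on_cylinder A T \<phi>" and \<phi>0: "\<And>y. y \<in> topspace M \<Longrightarrow> \<phi> y 0 = \<phi>0 y"
    and adm: "\<And>s. s \<in> {0..t} \<Longrightarrow> (\<lambda>y. \<phi> y s) \<in> admissible_potentials A chi"
    using sol J by (auto simp: flow_solution_def)
  have deriv: "(\<phi> y has_real_derivative Q_op A \<omega> chi F (\<lambda>y. \<phi> y s) y) (at s within {0..t})"
    if "y \<in> topspace M" "0 < s" "s \<le> t" for y s
  proof (rule DERIV_subset[OF _ J])
    have "s \<in> time_interval T" using that J by auto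
    then show "(\<phi> y has_real_derivative Q_op A \<omega> chi F (\<lambda>y. \<phi> y s) y) (at s within time_interval T)"
      using sol that(1) by (simp add: flow_solution_def)
  qed
  have cont\<phi>: "continuous_map ?X euclideanreal (\<lambda>p. \<phi> (fst p) (snd p))"
    using smooth_on_cylinder_continuous_map[OF M(1) smooth J] by (simp add: case_prod_unfold)
  have "continuous_map M euclideanreal \<psi>"
    using \<psi> by (intro smooth_function_continuous_map[OF M(1)]) (simp add: admissible_potentials_def)
  from continuous_map_compose[OF continuous_map_fst this]
  have cont\<psi>: "continuous_map ?X euclideanreal (\<lambda>p. \<psi> (fst p))" by (simp add: o_def)
  have conts: "continuous_map ?X euclideanreal (\<lambda>p. lam * snd p)"
    by (intro continuous_map_real_mult continuous_map_canonical_const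
        continuous_map_into_fulltopology[OF continuous_map_snd])
  show "\<psi> x + m \<le> \<phi> x t - lam * t"
    if Q: "\<And>y. y \<in> topspace M \<Longrightarrow> lam \<le> Q_op A \<omega> chi F \<psi> y"
      and init: "\<And>y. y \<in> topspace M \<Longrightarrow> m \<le> \<phi>0 y - \<psi> y"
  proof -
    have "m \<le> \<phi> x t - lam * t - \<psi> x"
    \<comment> \<open>The terms \<open>lam * 1\<close> and \<open>0\<close> in \<open>w\<close> keep
      the shape that the derivative rules produce.\<close>
    proof (rule parabolic_minimum_principle[OF M(2), where T = t and v = "\<lambda>y s. \<phi> y s - lam * s - \<psi> y"
          and w = "\<lambda>y s. Q_op A \<omega> chi F (\<lambda>y. \<phi> y s) y - lam * 1 - 0"])
      show "continuous_map ?X euclideanreal (\<lambda>(y, s). \<phi> y s - lam * s - \<psi> y)"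
        unfolding case_prod_beta by (intro continuous_map_diff cont\<phi> cont\<psi> conts)
      show "((\<lambda>s. \<phi> y s - lam * s - \<psi> y) has_real_derivative
          Q_op A \<omega> chi F (\<lambda>y. \<phi> y s) y - lam * 1 - 0) (at s within {0..t})"
        if "y \<in> topspace M" "0 < s" "s \<le> t" for y s
        by (intro DERIV_diff deriv that DERIV_cmult DERIV_ident DERIV_const)
      show "0 \<le> Q_op A \<omega> chi F (\<lambda>y. \<phi> y s) y - lam * 1 - 0"
        if y: "y \<in> topspace M" and s: "0 < s" "s \<le> t"
          and min: "\<And>z. z \<in> topspace M \<Longrightarrow> \<phi> y s - lam * s - \<psi> y \<le> \<phi> z s - lam * s - \<psi> z" for y s
      proof -
        \<comment> \<open>The common term \<open>lam * s\<close> cancels, so \<open>y\<close>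
          minimizes \<open>\<phi> - \<psi>\<close> at time \<open>s\<close>.\<close>
        have "Q_op A \<omega> chi F \<psi> y \<le> Q_op A \<omega> chi F (\<lambda>y. \<phi> y s) y"
          by (rule Q_op_mono_at_minimum[OF M(1) \<omega> adm \<psi> y]) (use s min in force)+
        then show ?thesis using Q[OF y] by simp
      qed
    qed (use x t0 init \<phi>0 in auto)
    then show ?thesis by simp
  qed
  show "\<phi> x t - lam * t \<le> \<psi> x + m"
    if Q: "\<And>y. y \<in> topspace M \<Longrightarrow> Q_op A \<omega> chi F \<psi> y \<le> lam"
      and init: "\<And>y. y \<in> topspace M \<Longrightarrow> \<phi>0 y - \<psi> y \<le> m"
  proof -
    \<comment> \<open>The upper bound is the minimum principle for the negated difference, so the
      two potentials exchange roles in \<open>Q_op_mono_at_minimum\<close>.\<close>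
    have "- m \<le> \<psi> x + lam * t - \<phi> x t"
    proof (rule parabolic_minimum_principle[OF M(2), where T = t and v = "\<lambda>y s. \<psi> y + lam * s - \<phi> y s"
          and w = "\<lambda>y s. 0 + lam * 1 - Q_op A \<omega> chi F (\<lambda>y. \<phi> y s) y"])
      show "continuous_map ?X euclideanreal (\<lambda>(y, s). \<psi> y + lam * s - \<phi> y s)"
        unfolding case_prod_beta by (intro continuous_map_diff continuous_map_add cont\<phi> cont\<psi> conts)
      show "((\<lambda>s. \<psi> y + lam * s - \<phi> y s) has_real_derivative
          0 + lam * 1 - Q_op A \<omega> chi F (\<lambda>y. \<phi> y s) y) (at s within {0..t})"
        if "y \<in> topspace M" "0 < s" "s \<le> t" for y s
        by (intro DERIV_diff DERIV_add deriv that DERIV_cmult DERIV_ident DERIV_const)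
      show "0 \<le> 0 + lam * 1 - Q_op A \<omega> chi F (\<lambda>y. \<phi> y s) y"
        if y: "y \<in> topspace M" and s: "0 < s" "s \<le> t"
          and min: "\<And>z. z \<in> topspace M \<Longrightarrow> \<psi> y + lam * s - \<phi> y s \<le> \<psi> z + lam * s - \<phi> z s" for y s
      proof -
        have "Q_op A \<omega> chi F (\<lambda>y. \<phi> y s) y \<le> Q_op A \<omega> chi F \<psi> y"
          by (rule Q_op_mono_at_minimum[OF M(1) \<omega> \<psi> adm y]) (use s min in force)+
        then show ?thesis using Q[OF y] by simp
      qed
    next
      fix y assume "y \<in> topspace M"
      then show "- m \<le> \<psi> y + lam * 0 - \<phi> y 0" using init[of y] \<phi>0 by simp
    qed (use x t0 in auto)
    then show ?thesis by simp
  qed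
qed

theorem lemma4p2:
  fixes M :: "'a topology"
    and A :: "('a, 'n::finite) chart set"
    and \<omega> chi :: "('a, 'n) form11"
    and F \<phi>_low \<phi>_up :: "'a \<Rightarrow> real"
    and lam :: real
  assumes "complex_manifold M A" and "compact_space M" and "connected_space M"
    and "CARD('n) \<ge> 2"
    and "hermitian_metric A \<omega>" and "hermitian_metric A chi"
    and "smooth_function A F"
    and "\<phi>_low \<in> admissible_potentials A chi" and "\<phi>_up \<in> admissible_potentials A chi"
    and "\<forall>x\<in>topspace M. Q_op A \<omega> chi F \<phi>_low x \<ge> lam"
    and "\<forall>x\<in>topspace M. Q_op A \<omega> chi F \<phi>_up x \<le> lam"
  shows "\<forall>\<phi>0 \<in> admissible_potentials A chi.
           (\<exists>A0 B0 :: real. \<forall>T \<phi>. maximal_flow_solution M A \<omega> chi F \<phi>0 T \<phi> \<longrightarrow>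
              (\<forall>t\<in>time_interval T. \<forall>x\<in>topspace M.
                 \<phi>_low x + A0 \<le> \<phi> x t - lam * t \<and> \<phi> x t - lam * t \<le> \<phi>_up x + B0)) \<and>
           (\<exists>C :: real. \<forall>T \<phi>. maximal_flow_solution M A \<omega> chi F \<phi>0 T \<phi> \<longrightarrow>
              (SUP (x, t) \<in> topspace M \<times> time_interval T. ereal \<bar>\<phi> x t - lam * t\<bar>) \<le> ereal C)"
proof
  fix \<phi>0 assume \<phi>0: "\<phi>0 \<in> admissible_potentials A chi"
  have cont: "continuous_map M euclideanreal \<psi>" if "\<psi> \<in> admissible_potentials A chi" for \<psi>
    using that by (intro smooth_function_continuous_map[OF assms(1)]) (simp add: admissible_potentials_def)
  obtain b0 where b0: "\<forall>x\<in>topspace M. \<bar>\<phi>0 x\<bar> \<le> b0"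
    by (rule compact_space_bounded[OF assms(2) cont[OF \<phi>0]])
  obtain b1 where b1: "\<forall>x\<in>topspace M. \<bar>\<phi>_low x\<bar> \<le> b1"
    by (rule compact_space_bounded[OF assms(2) cont[OF assms(8)]])
  obtain b2 where b2: "\<forall>x\<in>topspace M. \<bar>\<phi>_up x\<bar> \<le> b2"
    by (rule compact_space_bounded[OF assms(2) cont[OF assms(9)]])
  \<comment> \<open>The constants come from sup bounds of the initial value and the two barriers
    only, so they can be fixed before \<open>T\<close> and \<open>\<phi>\<close>.\<close>
  have bounds: "\<phi>_low x + (- b0 - b1) \<le> \<phi> x t - lam * t" "\<phi> x t - lam * t \<le> \<phi>_up x + (b0 + b2)"
    if "maximal_flow_solution M A \<omega> chi F \<phi>0 T \<phi>" "t \<in> time_interval T" "x \<in> topspace M" for T \<phi> t x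
  proof -
    have sol: "flow_solution M A \<omega> chi F \<phi>0 T \<phi>"
      using that(1) by (simp add: maximal_flow_solution_def)
    have "- b0 - b1 \<le> \<phi>0 y - \<phi>_low y" if "y \<in> topspace M" for y
      using bspec[OF b0 that] bspec[OF b1 that] by linarith
    then show "\<phi>_low x + (- b0 - b1) \<le> \<phi> x t - lam * t"
      using assms(10) by (intro flow_lower_bound[OF assms(1,2,5) sol assms(8) that(2,3)]) simp_all
    have "\<phi>0 y - \<phi>_up y \<le> b0 + b2" if "y \<in> topspace M" for y
      using bspec[OF b0 that] bspec[OF b2 that] by linarith
    then show "\<phi> x t - lam * t \<le> \<phi>_up x + (b0 + b2)"
      using assms(11) by (intro flow_upper_bound[OF assms(1,2,5) sol assms(9) that(2,3)]) simp_all
  qed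
  \<comment> \<open>The lower bound costs \<open>b0 + 2 * b1\<close> and the upper one
    \<open>b0 + 2 * b2\<close>; this constant dominates both.\<close>
  have "(SUP (x, t) \<in> topspace M \<times> time_interval T. ereal \<bar>\<phi> x t - lam * t\<bar>) \<le> ereal (b0 + 2 * \<bar>b1\<bar> + 2 * \<bar>b2\<bar>)"
    if "maximal_flow_solution M A \<omega> chi F \<phi>0 T \<phi>" for T \<phi>
  proof (rule SUP_least)
    fix p assume "p \<in> topspace M \<times> time_interval T"
    then obtain x t where p: "p = (x, t)" and x: "x \<in> topspace M" and t: "t \<in> time_interval T" by blast
    have "\<bar>\<phi> x t - lam * t\<bar> \<le> b0 + 2 * \<bar>b1\<bar> + 2 * \<bar>b2\<bar>"
      using bounds[OF that t x] bspec[OF b0 x] bspec[OF b1 x] bspec[OF b2 x] by linarith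
    then show "(case p of (x, t) \<Rightarrow> ereal \<bar>\<phi> x t - lam * t\<bar>) \<le> ereal (b0 + 2 * \<bar>b1\<bar> + 2 * \<bar>b2\<bar>)"
      by (simp add: p)
  qed
  with bounds show "(\<exists>A0 B0 :: real. \<forall>T \<phi>. maximal_flow_solution M A \<omega> chi F \<phi>0 T \<phi> \<longrightarrow>
              (\<forall>t\<in>time_interval T. \<forall>x\<in>topspace M.
                 \<phi>_low x + A0 \<le> \<phi> x t - lam * t \<and> \<phi> x t - lam * t \<le> \<phi>_up x + B0)) \<and>
           (\<exists>C :: real. \<forall>T \<phi>. maximal_flow_solution M A \<omega> chi F \<phi>0 T \<phi> \<longrightarrow>
              (SUP (x, t) \<in> topspace M \<times> time_interval T. ereal \<bar>\<phi> x t - lam * t\<bar>) \<le> ereal C)"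
    by blast
qed

end
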